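(* Let $X,Y,Z,W$ be Banach spaces, $F_{1}:X\rightrightarrows Y$, $F_{2}:X\rightrightarrows Z$ and $G:Y\times Z\rightrightarrows W$ be three multifunctions and $(\overline{x},\overline{y},\overline{z},\overline{w})\in X\times Y\times Z\times W$ be such that $(\overline{x},\overline{y})\in\operatorname{Gr}F_{1}$, $(\overline{x},\overline{z})\in\operatorname{Gr}F_{2}$ and $((\overline{y},\overline{z}),\overline{w})\in\operatorname{Gr}G$. Let $H:X\rightrightarrows W$ be given by $$H(x):=G(F_{1}(x),F_{2}(x))=\bigcup_{y\in F_1(x),\,z\in F_2(x)}G(y,z)\quad\text{for every }x\in X,$$ and suppose that the following assumptions are satisfied: (i) $\operatorname{Gr}F_{1}$, $\operatorname{Gr}F_{2}$ and $\operatorname{Gr}G$ are locally closed around $(\overline{x},\overline{y})$, $(\overline{x},\overline{z})$ and $((\overline{y},\overline{z}),\overline{w})$, respectively; (ii) $F_{1}$ is open at linear rate $L>0$ around $(\overline{x},\overline{y})$; (iii) $F_{2}$ is Lipschitz-like around $(\overline{x},\overline{z})$ with constant $M>0$; (iv) $G$ is open at linear rate with respect to $y$ uniformly in $z$ around $((\overline{y},\overline{z}),\overline{w})$ with constant $C>0$; (v) $G$ is Lipschitz-like with respect to $z$ uniformly in $y$ around $((\overline{y},\overline{z}),\overline{w})$ with constant $D\geq0$; (vi) $LC-MD>0$. Then there exists $\varepsilon>0$ such that, for every $\rho\in(0,\varepsilon)$, $$B(\overline{w},(LC-MD)\rho)\subset H(B(\overline{x},\rho)).$$ Moreover, for every $\rho\in(0,2^{-1}\varepsilon)$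 and every $(x,y,z,w)\in B(\overline{x},2^{-1}\varepsilon)\times B(\overline{y},2^{-1}\varepsilon)\times B(\overline{z},2^{-1}\varepsilon)\times B(\overline{w},2^{-1}\varepsilon)$ such that $(y,z)\in F_{1}(x)\times F_{2}(x)$ and $w\in G(y,z)$, $$B(w,(LC-MD)\rho)\subset H(B(x,\rho)).$$
   Context: A multifunction $F:X\rightrightarrows Y$ assigns to each $x$ a (possibly empty) subset $F(x)\subset Y$; $\operatorname{Gr}F=\{(x,y)\mid y\in F(x)\}$; $F(A):=\bigcup_{x\in A}F(x)$. $B(x,r)$ is the open ball with center $x$ and radius $r$; $\mathbb{D}_Y$ is the closed unit ball of $Y$. Product spaces carry the sum norm. A set is locally closed around a point if its intersection with some closed neighborhood of that point is closed. $F$ is open at linear rate $L>0$ around $(\overline{x},\overline{y})\in\operatorname{Gr}F$ if there exist $\varepsilon>0$ and neighborhoods $U$ of $\overline{x}$, $V$ of $\overline{y}$ such that, for every $\rho\in(0,\varepsilon)$ and every $(x,y)\in\operatorname{Gr}F\cap[U\times V]$, $B(y,\rho L)\subset F(B(x,\rho))$. $F$ is Lipschitz-like around $(\overline{x},\overline{y})$ with constant $M$ if there exist neighborhoods $U$ of $\overline{x}$, $V$ of $\overline{y}$ such that, for every $x,u\in U$, $F(x)\cap V\subset F(u)+M\|x-u\|\mathbb{D}_Y$. $G:Y\times Z\rightrightarrows W$ is open at linear rate with respect to $y$ uniformly in $z$ around $((\overline{y},\overline{z}),\overline{w})\in\operatorname{Gr}G$ with constant $C>0$ if there exist $\varepsilon>0$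 and neighborhoods $U$ of $\overline{y}$, $V$ of $\overline{z}$, $N$ of $\overline{w}$ such that, for every $\rho\in(0,\varepsilon)$, every $z\in V$ and every $(y,w)\in U\times N$ with $w\in G(y,z)$, $B(w,\rho C)\subset G(B(y,\rho)\times\{z\})$. $G$ is Lipschitz-like with respect to $z$ uniformly in $y$ around $((\overline{y},\overline{z}),\overline{w})$ with constant $D\ge 0$ if there exist neighborhoods $U$ of $\overline{y}$, $V$ of $\overline{z}$, $N$ of $\overline{w}$ such that, for every $z,z'\in V$ and every $y\in U$, $G(y,z)\cap N\subset G(y,z')+D\|z-z'\|\mathbb{D}_W$. *)

theory Defs
  imports "HOL-Analysis.Analysis" "HOL-Library.Set_Algebras"
begin

text \<open>
  A multifunction from X to Y is a function of type \<^typ>\<open>'x \<Rightarrow> 'y set\<close>; values may be empty.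
  A neighborhood of a point is any set (not necessarily open) having that point in its interior.
  Product norms never occur below: on products only the topology is used, which is the same for
  the sum norm and for the library's Euclidean product norm.
\<close>

definition mf_graph :: "('a \<Rightarrow> 'b set) \<Rightarrow> ('a \<times> 'b) set" where
  "mf_graph F = {(x, y). y \<in> F x}"

definition mf_image :: "('a \<Rightarrow> 'b set) \<Rightarrow> 'a set \<Rightarrow> 'b set" where
  "mf_image F A = (\<Union>x\<in>A. F x)"

definition locally_closed_around :: "'a::topological_space set \<Rightarrow> 'a \<Rightarrow> bool" where
  "locally_closed_around S a \<longleftrightarrow> (\<exists>K. closed K \<and> a \<in> interior K \<and> closed (S \<inter> K))"

definition open_at_linear_rate ::
  "('x::real_normed_vector \<Rightarrow> 'y::real_normed_vector set) \<Rightarrow> real \<Rightarrow> 'x \<times> 'y \<Rightarrow> bool" where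
  "open_at_linear_rate F L = (\<lambda>(xb, yb).
     \<exists>\<epsilon>>0. \<exists>U V. xb \<in> interior U \<and> yb \<in> interior V \<and>
       (\<forall>\<rho>\<in>{0<..<\<epsilon>}. \<forall>(x, y) \<in> mf_graph F \<inter> (U \<times> V).
          ball y (\<rho> * L) \<subseteq> mf_image F (ball x \<rho>)))"

definition lipschitz_like ::
  "('x::real_normed_vector \<Rightarrow> 'y::real_normed_vector set) \<Rightarrow> real \<Rightarrow> 'x \<times> 'y \<Rightarrow> bool" where
  "lipschitz_like F M = (\<lambda>(xb, yb).
     \<exists>U V. xb \<in> interior U \<and> yb \<in> interior V \<and>
       (\<forall>x\<in>U. \<forall>u\<in>U. F x \<inter> V \<subseteq> F u + (*\<^sub>R) (M * norm (x - u)) ` cball 0 1))"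

definition open_at_linear_rate_fst_uniformly ::
  "('y::real_normed_vector \<times> 'z::real_normed_vector \<Rightarrow> 'w::real_normed_vector set) \<Rightarrow> real
    \<Rightarrow> ('y \<times> 'z) \<times> 'w \<Rightarrow> bool" where
  "open_at_linear_rate_fst_uniformly G C = (\<lambda>((yb, zb), wb).
     \<exists>\<epsilon>>0. \<exists>U V N. yb \<in> interior U \<and> zb \<in> interior V \<and> wb \<in> interior N \<and>
       (\<forall>\<rho>\<in>{0<..<\<epsilon>}. \<forall>z\<in>V. \<forall>(y, w) \<in> U \<times> N. w \<in> G (y, z) \<longrightarrow>
          ball w (\<rho> * C) \<subseteq> mf_image G (ball y \<rho> \<times> {z})))"

definition lipschitz_like_snd_uniformly ::
  "('y::real_normed_vector \<times> 'z::real_normed_vector \<Rightarrow> 'w::real_normed_vector set) \<Rightarrow> real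
    \<Rightarrow> ('y \<times> 'z) \<times> 'w \<Rightarrow> bool" where
  "lipschitz_like_snd_uniformly G D = (\<lambda>((yb, zb), wb).
     \<exists>U V N. yb \<in> interior U \<and> zb \<in> interior V \<and> wb \<in> interior N \<and>
       (\<forall>z\<in>V. \<forall>z'\<in>V. \<forall>y\<in>U.
          G (y, z) \<inter> N \<subseteq> G (y, z') + (*\<^sub>R) (D * norm (z - z')) ` cball 0 1))"

end

theory Submission
  imports Defs
begin

text \<open>
  The theorem is a Lyusternik--Graves iteration.  Let \<open>w \<in> G (y, z)\<close> with \<open>y \<in> F1 x\<close>,
  \<open>z \<in> F2 x\<close>, and let \<open>v\<close> be a target close to \<open>w\<close>.  If \<open>norm (w - v) < L * C * \<sigma>\<close>,
  openness of \<open>G\<close> in its first variable gives \<open>y'\<close> within \<open>L * \<sigma>\<close> of \<open>y\<close> with \<open>v \<in> G (y', z)\<close>,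
  and openness of \<open>F1\<close> gives \<open>x'\<close> within \<open>\<sigma>\<close> of \<open>x\<close> with \<open>y' \<in> F1 x'\<close>.  The old \<open>z\<close> need not lie in
  \<open>F2 x'\<close>, but by the Lipschitz property of \<open>F2\<close> some \<open>z' \<in> F2 x'\<close> lies within \<open>M * \<sigma>\<close> of it, and
  by the Lipschitz property of \<open>G\<close> replacing \<open>z\<close> by \<open>z'\<close> turns the exact solution \<open>v\<close> into some
  \<open>w' \<in> G (y', z')\<close> with error at most \<open>M * D * \<sigma>\<close>.  One such correction (lemma \<open>correction_step\<close>)
  therefore multiplies the error bound by \<open>M * D / (L * C) < 1\<close>.

  Iterating with \<open>\<sigma>\<close> replaced by the terms \<open>q ^ n * ((1 - q) * \<rho>)\<close> of a geometric series of sum \<open>\<rho>\<close>,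
  where \<open>M * D / (L * C) < q < 1\<close>, produces Cauchy sequences of points whose total displacement in the
  space of \<open>x\<close> is at most \<open>\<rho>\<close>.  The closed graphs pass the three inclusions to the limit, so \<open>v\<close>
  is attained exactly (lemma \<open>target_attained\<close>).  The first step asks for
  \<open>norm (w - v) < L * C * (1 - q) * \<rho>\<close>, and letting \<open>q\<close> decrease to \<open>M * D / (L * C)\<close> yields the rate
  \<open>L * C - M * D\<close>.

  All estimates are uniform in the starting point as long as it is near the reference point, which
  gives both assertions of the theorem at once.
\<close>

section \<open>Local hypotheses on balls of a common radius\<close>

text \<open>
  Each hypothesis of the theorem comes with neighbourhoods of its own.  Phrasing each of them as
  holding eventually as the radius tends to zero from the right lets them be combined into one radius.
\<close>

lemma eventually_cball_subset:
  fixes a :: "'a::metric_space"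
  assumes "a \<in> interior U"
  shows "\<forall>\<^sub>F R in at_right 0. cball a R \<subseteq> U"
proof -
  obtain e where e: "e > 0" "cball a e \<subseteq> U"
    using assms mem_interior_cball by blast
  have "\<forall>\<^sub>F R in at_right 0. R < e"
    using e(1) by (auto intro: eventually_at_rightI)
  then show ?thesis
    by eventually_elim (use e(2) in force)
qed

lemma eventually_closed_Int_cball:
  assumes "locally_closed_around S (a :: 'a::metric_space)"
  shows "\<forall>\<^sub>F R in at_right 0. closed (S \<inter> cball a R)"
proof -
  obtain K where K: "a \<in> interior K" "closed (S \<inter> K)"
    using assms unfolding locally_closed_around_def by blast
  show ?thesis
    using eventually_cball_subset[OF K(1)]
  proof eventually_elim
    case (elim R)
    then have "S \<inter> cball a R = (S \<inter> K) \<inter> cball a R" by blast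
    then show ?case using K(2) by (metis closed_Int closed_cball)
  qed
qed

lemma eventually_open_at_linear_rate:
  assumes "open_at_linear_rate F L (xb, yb)"
  shows "\<forall>\<^sub>F R in at_right 0. \<forall>x\<in>cball xb R. \<forall>y\<in>F x \<inter> cball yb R. \<forall>\<sigma>\<in>{0<..<R}.
           ball y (\<sigma> * L) \<subseteq> mf_image F (ball x \<sigma>)"
proof -
  obtain e U V where e: "e > 0" and UV: "xb \<in> interior U" "yb \<in> interior V"
    and *: "\<forall>\<sigma>\<in>{0<..<e}. \<forall>(x, y) \<in> mf_graph F \<inter> (U \<times> V). ball y (\<sigma> * L) \<subseteq> mf_image F (ball x \<sigma>)"
    using assms unfolding open_at_linear_rate_def by auto
  have "\<forall>\<^sub>F R in at_right 0. R < e"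
    using e by (auto intro: eventually_at_rightI)
  with eventually_cball_subset[OF UV(1)] eventually_cball_subset[OF UV(2)] show ?thesis
  proof eventually_elim
    case (elim R)
    show ?case
    proof (intro ballI)
      fix x y \<sigma> assume "x \<in> cball xb R" "y \<in> F x \<inter> cball yb R" "\<sigma> \<in> {0<..<R}"
      then have "(x, y) \<in> mf_graph F \<inter> (U \<times> V)" "\<sigma> \<in> {0<..<e}"
        using elim unfolding mf_graph_def by auto
      with * show "ball y (\<sigma> * L) \<subseteq> mf_image F (ball x \<sigma>)" by blast
    qed
  qed
qed

lemma eventually_open_at_linear_rate_fst_uniformly:
  assumes "open_at_linear_rate_fst_uniformly G C ((yb, zb), wb)"
  shows "\<forall>\<^sub>F R in at_right 0. \<forall>y\<in>cball yb R. \<forall>z\<in>cball zb R. \<forall>w\<in>G (y, z) \<inter> cball wb R.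
           \<forall>\<sigma>\<in>{0<..<R}. ball w (\<sigma> * C) \<subseteq> mf_image G (ball y \<sigma> \<times> {z})"
proof -
  obtain e U V N where e: "e > 0"
    and UVN: "yb \<in> interior U" "zb \<in> interior V" "wb \<in> interior N"
    and *: "\<forall>\<sigma>\<in>{0<..<e}. \<forall>z\<in>V. \<forall>(y, w) \<in> U \<times> N. w \<in> G (y, z) \<longrightarrow>
              ball w (\<sigma> * C) \<subseteq> mf_image G (ball y \<sigma> \<times> {z})"
    using assms unfolding open_at_linear_rate_fst_uniformly_def by auto
  have "\<forall>\<^sub>F R in at_right 0. R < e"
    using e by (auto intro: eventually_at_rightI)
  with UVN[THEN eventually_cball_subset] show ?thesis
  proof eventually_elim
    case (elim R)
    show ?case
    proof (intro ballI)
      fix y z w \<sigma>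
      assume "y \<in> cball yb R" "z \<in> cball zb R" "w \<in> G (y, z) \<inter> cball wb R" "\<sigma> \<in> {0<..<R}"
      then have "z \<in> V" "(y, w) \<in> U \<times> N" "w \<in> G (y, z)" "\<sigma> \<in> {0<..<e}"
        using elim by auto
      with * show "ball w (\<sigma> * C) \<subseteq> mf_image G (ball y \<sigma> \<times> {z})" by blast
    qed
  qed
qed

lemma plus_scaled_unit_ball_dist:
  fixes a :: "'a::real_normed_vector"
  assumes "a \<in> S + (*\<^sub>R) r ` cball 0 1" and "0 \<le> r"
  obtains b where "b \<in> S" "dist b a \<le> r"
proof -
  obtain b u where b: "b \<in> S" "norm u \<le> 1" "a = b + r *\<^sub>R u"
    using assms(1) by (auto simp: set_plus_def)
  then have "dist b a \<le> r"
    using assms(2) by (simp add: dist_norm mult_left_le)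
  with b(1) show thesis by (rule that)
qed

lemma eventually_lipschitz_like:
  assumes "lipschitz_like F M (xb, yb)" and "0 \<le> M"
  shows "\<forall>\<^sub>F R in at_right 0. \<forall>x\<in>cball xb R. \<forall>u\<in>cball xb R. \<forall>y\<in>F x \<inter> cball yb R.
           \<exists>y'\<in>F u. dist y' y \<le> M * dist x u"
proof -
  obtain U V where UV: "xb \<in> interior U" "yb \<in> interior V"
    and *: "\<forall>x\<in>U. \<forall>u\<in>U. F x \<inter> V \<subseteq> F u + (*\<^sub>R) (M * norm (x - u)) ` cball 0 1"
    using assms unfolding lipschitz_like_def by auto
  show ?thesis
    using UV[THEN eventually_cball_subset]
  proof eventually_elim
    case (elim R)
    show ?case
    proof (intro ballI)
      fix x u y assume "x \<in> cball xb R" "u \<in> cball xb R" "y \<in> F x \<inter> cball yb R"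
      then have "y \<in> F u + (*\<^sub>R) (M * norm (x - u)) ` cball 0 1"
        using * elim by blast
      then obtain y' where "y' \<in> F u" "dist y' y \<le> M * norm (x - u)"
        by (rule plus_scaled_unit_ball_dist) (simp add: \<open>0 \<le> M\<close>)
      then show "\<exists>y'\<in>F u. dist y' y \<le> M * dist x u"
        by (auto simp: dist_norm)
    qed
  qed
qed

lemma eventually_lipschitz_like_snd_uniformly:
  assumes "lipschitz_like_snd_uniformly G D ((yb, zb), wb)" and "0 \<le> D"
  shows "\<forall>\<^sub>F R in at_right 0. \<forall>y\<in>cball yb R. \<forall>z\<in>cball zb R. \<forall>z'\<in>cball zb R.
           \<forall>w\<in>G (y, z) \<inter> cball wb R. \<exists>w'\<in>G (y, z'). dist w' w \<le> D * dist z z'"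
proof -
  obtain U V N where UVN: "yb \<in> interior U" "zb \<in> interior V" "wb \<in> interior N"
    and *: "\<forall>z\<in>V. \<forall>z'\<in>V. \<forall>y\<in>U. G (y, z) \<inter> N \<subseteq> G (y, z') + (*\<^sub>R) (D * norm (z - z')) ` cball 0 1"
    using assms unfolding lipschitz_like_snd_uniformly_def by auto
  show ?thesis
    using UVN[THEN eventually_cball_subset]
  proof eventually_elim
    case (elim R)
    show ?case
    proof (intro ballI)
      fix y z z' w
      assume "y \<in> cball yb R" "z \<in> cball zb R" "z' \<in> cball zb R" "w \<in> G (y, z) \<inter> cball wb R"
      then have "w \<in> G (y, z') + (*\<^sub>R) (D * norm (z - z')) ` cball 0 1"
        using * elim by blast
      then obtain w' where "w' \<in> G (y, z')" "dist w' w \<le> D * norm (z - z')"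
        by (rule plus_scaled_unit_ball_dist) (simp add: \<open>0 \<le> D\<close>)
      then show "\<exists>w'\<in>G (y, z'). dist w' w \<le> D * dist z z'"
        by (auto simp: dist_norm)
    qed
  qed
qed

section \<open>Sequences with geometrically decreasing steps\<close>

lemma geometric_steps_convergent:
  fixes s :: "nat \<Rightarrow> 'a::banach"
  assumes q: "0 < q" "q < 1" and step: "\<And>n. dist (s (Suc n)) (s n) \<le> c * q ^ n"
  shows "convergent s"
proof -
  have "summable (\<lambda>n. c * q ^ n)"
    using q by (intro summable_mult summable_geometric) simp
  then have "summable (\<lambda>n. s (Suc n) - s n)"
    by (rule summable_comparison_test'[where N = 0]) (use step in \<open>simp only: dist_norm\<close>)
  then have "(\<lambda>n. \<Sum>k<n. s (Suc k) - s k) \<longlonglongrightarrow> (\<Sum>n. s (Suc n) - s n)"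
    by (rule summable_LIMSEQ)
  then have "(\<lambda>n. s n - s 0 + s 0) \<longlonglongrightarrow> (\<Sum>n. s (Suc n) - s n) + s 0"
    unfolding sum_lessThan_telescope by (intro tendsto_intros)
  then show ?thesis
    by (auto simp: convergent_def)
qed

section \<open>The iteration\<close>

text \<open>
  Fixing one radius \<open>R\<close>, both for the balls and as bound for the step sizes in the openness
  properties, separates the iteration from the choice of neighbourhoods: it only remains to check
  that no iterate leaves these balls.
\<close>

locale local_composition =
  fixes F1 :: "'x::banach \<Rightarrow> 'y::banach set"
    and F2 :: "'x \<Rightarrow> 'z::banach set"
    and G :: "'y \<times> 'z \<Rightarrow> 'w::banach set"
    and xb :: 'x and yb :: 'y and zb :: 'z and wb :: 'w
    and L M C D R :: real
  assumes L_pos: "L > 0" and M_pos: "M > 0" and C_pos: "C > 0" and D_nonneg: "D \<ge> 0"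
    and closed_F1: "closed (mf_graph F1 \<inter> cball (xb, yb) R)"
    and closed_F2: "closed (mf_graph F2 \<inter> cball (xb, zb) R)"
    and closed_G: "closed (mf_graph G \<inter> cball ((yb, zb), wb) R)"
    and open_F1: "\<lbrakk>x \<in> cball xb R; y \<in> F1 x; y \<in> cball yb R; 0 < \<sigma>; \<sigma> < R\<rbrakk>
      \<Longrightarrow> ball y (\<sigma> * L) \<subseteq> mf_image F1 (ball x \<sigma>)"
    and lipschitz_F2: "\<lbrakk>x \<in> cball xb R; u \<in> cball xb R; z \<in> F2 x; z \<in> cball zb R\<rbrakk>
      \<Longrightarrow> \<exists>z'\<in>F2 u. dist z' z \<le> M * dist x u"
    and open_G: "\<lbrakk>y \<in> cball yb R; z \<in> cball zb R; w \<in> G (y, z); w \<in> cball wb R; 0 < \<sigma>; \<sigma> < R\<rbrakk>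
      \<Longrightarrow> ball w (\<sigma> * C) \<subseteq> mf_image G (ball y \<sigma> \<times> {z})"
    and lipschitz_G: "\<lbrakk>y \<in> cball yb R; z \<in> cball zb R; z' \<in> cball zb R; w \<in> G (y, z); w \<in> cball wb R\<rbrakk>
      \<Longrightarrow> \<exists>w'\<in>G (y, z'). dist w' w \<le> D * dist z z'"
begin

text \<open>
  The first variable of \<open>G\<close> is moved so as to hit \<open>v\<close> exactly; keeping the three inclusions then
  costs an adjustment of \<open>z\<close>, which spoils \<open>v\<close> only by the product of the two Lipschitz constants.
\<close>

lemma correction_step:
  assumes y: "y \<in> F1 x" and z: "z \<in> F2 x" and w: "w \<in> G (y, z)"
    and \<sigma>: "0 < \<sigma>" "\<sigma> < R" "L * \<sigma> < R"
    and near: "dist xb x + \<sigma> \<le> R" "dist yb y + L * \<sigma> \<le> R" "dist zb z + M * \<sigma> \<le> R"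
    and wv: "w \<in> cball wb R" "v \<in> cball wb R" "dist w v < L * C * \<sigma>"
  obtains x' y' z' w' where "y' \<in> F1 x'" "z' \<in> F2 x'" "w' \<in> G (y', z')"
    "dist x' x \<le> \<sigma>" "dist y' y \<le> L * \<sigma>" "dist z' z \<le> M * \<sigma>" "dist w' v \<le> M * D * \<sigma>"
proof -
  have L\<sigma>: "0 < L * \<sigma>" and M\<sigma>: "0 < M * \<sigma>"
    using L_pos M_pos \<sigma> by simp_all
  have xyz: "x \<in> cball xb R" "y \<in> cball yb R" "z \<in> cball zb R"
    using near \<sigma>(1) L\<sigma> M\<sigma> by auto
  have "v \<in> ball w ((L * \<sigma>) * C)"
    using wv(3) by (simp add: ac_simps)
  also have "\<dots> \<subseteq> mf_image G (ball y (L * \<sigma>) \<times> {z})"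
    using open_G[OF xyz(2,3) w wv(1) L\<sigma> \<sigma>(3)] .
  finally obtain y' where y': "dist y y' < L * \<sigma>" "v \<in> G (y', z)"
    by (auto simp: mf_image_def)
  have "y' \<in> ball y (\<sigma> * L)"
    using y'(1) by (simp add: mult.commute)
  also have "\<dots> \<subseteq> mf_image F1 (ball x \<sigma>)"
    using open_F1[OF xyz(1) y xyz(2) \<sigma>(1,2)] .
  finally obtain x' where x': "dist x x' < \<sigma>" "y' \<in> F1 x'"
    by (auto simp: mf_image_def)
  have x'R: "x' \<in> cball xb R"
    using x'(1) near(1) dist_triangle[of xb x' x] by simp
  have y'R: "y' \<in> cball yb R"
    using y'(1) near(2) dist_triangle[of yb y' y] by simp
  obtain z' where z': "z' \<in> F2 x'" "dist z' z \<le> M * dist x x'"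
    using lipschitz_F2[OF xyz(1) x'R z xyz(3)] by blast
  have z'z: "dist z' z \<le> M * \<sigma>"
    using z'(2) x'(1) M_pos by (smt (verit) mult_left_mono)
  have z'R: "z' \<in> cball zb R"
    using z'z near(3) dist_triangle[of zb z' z] by (simp add: dist_commute)
  obtain w' where w': "w' \<in> G (y', z')" "dist w' v \<le> D * dist z z'"
    using lipschitz_G[OF y'R xyz(3) z'R y'(2) wv(2)] by blast
  have "dist w' v \<le> M * D * \<sigma>"
    using w'(2) mult_left_mono[OF z'z D_nonneg] by (simp add: dist_commute ac_simps)
  then show thesis
    using that[OF x'(2) z'(1) w'(1)] x'(1) y'(1) z'z by (simp add: dist_commute)
qed

text \<open>
  The \<open>n\<close>-th iterate has moved from the starting point by at most \<open>(1 - q ^ n) * \<rho>\<close>, times \<open>1\<close>, \<open>L\<close>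
  or \<open>M\<close> in the spaces of \<open>x\<close>, \<open>y\<close> and \<open>z\<close>, and its error is less than \<open>L * C\<close> times the next
  step size \<open>q ^ n * ((1 - q) * \<rho>)\<close>; as \<open>M * D < q * (L * C)\<close>, a correction step reproduces these
  bounds with \<open>Suc n\<close>.

  The starting point, the total displacement and one further step each contribute to the distance
  from the reference point, whence the condition on \<open>\<eta>\<close>.  It aims at \<open>R / 3\<close> in each factor because
  the graph of \<open>G\<close> lives in a product of three factors, where distances are at most the sum of the
  three distances.
\<close>

lemma target_attained:
  assumes q: "0 < q" "q < 1" "M * D < q * (L * C)"
    and start: "y0 \<in> F1 x0" "z0 \<in> F2 x0" "w0 \<in> G (y0, z0)"
    and near: "x0 \<in> ball xb \<eta>" "y0 \<in> ball yb \<eta>" "z0 \<in> ball zb \<eta>" "w0 \<in> ball wb \<eta>"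
    and \<rho>: "0 < \<rho>" "\<rho> < \<eta>"
    and \<eta>: "\<eta> * (3 + 2 * (L + M + L * C)) \<le> R / 3"
    and v: "dist w0 v < L * C * ((1 - q) * \<rho>)"
  obtains x y z where "y \<in> F1 x" "z \<in> F2 x" "v \<in> G (y, z)" "dist x0 x \<le> \<rho>"
proof -
  have pos: "0 < L * C" "0 < \<eta>" using L_pos C_pos \<rho> by simp_all
  have small: "\<rho> \<le> \<eta>" "L * \<rho> \<le> L * \<eta>" "M * \<rho> \<le> M * \<eta>" "L * C * \<rho> \<le> L * C * \<eta>"
    using L_pos M_pos C_pos \<rho> by (simp_all add: mult.assoc)
  have prods: "0 < L * \<eta>" "0 < M * \<eta>" "0 < L * C * \<eta>"
    using L_pos M_pos pos by simp_all
  have \<eta>': "3 * \<eta> + 2 * (L * \<eta>) + 2 * (M * \<eta>) + 2 * (L * C * \<eta>) \<le> R / 3"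
    using \<eta> by (simp add: algebra_simps)
  have near': "dist xb x0 < \<eta>" "dist yb y0 < \<eta>" "dist zb z0 < \<eta>" "dist wb w0 < \<eta>"
    using near by simp_all
  define \<sigma> where "\<sigma> n = q ^ n * ((1 - q) * \<rho>)" for n
  have \<sigma>_pos: "0 < \<sigma> n" for n
    using q \<rho> by (simp add: \<sigma>_def)
  \<comment> \<open>The step sizes telescope, so the bound on the displacement after \<open>n\<close> steps is closed under a step.\<close>
  have acc: "(1 - q ^ n) * \<rho> + \<sigma> n = (1 - q ^ Suc n) * \<rho>" for n
    by (simp add: \<sigma>_def algebra_simps)
  have acc_le: "(1 - q ^ n) * \<rho> \<le> \<rho>" for n
    using q \<rho> by (simp add: algebra_simps)
  have acc_nonneg: "0 \<le> (1 - q ^ n) * \<rho>" for n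
    using q \<rho> by (simp add: power_le_one)
  have \<sigma>_le: "\<sigma> n \<le> \<rho>" for n
    using acc[of n] acc_nonneg[of n] acc_le[of "Suc n"] by linarith
  define invar where "invar n = (\<lambda>(x, y, z, w).
      y \<in> F1 x \<and> z \<in> F2 x \<and> w \<in> G (y, z) \<and> dist x0 x \<le> (1 - q ^ n) * \<rho> \<and>
      dist y0 y \<le> L * ((1 - q ^ n) * \<rho>) \<and> dist z0 z \<le> M * ((1 - q ^ n) * \<rho>) \<and>
      dist w v < L * C * \<sigma> n)" for n
  have bounds: "dist xb x + \<rho> \<le> R / 3" "dist yb y + L * \<rho> \<le> R / 3" "dist zb z + M * \<rho> \<le> R / 3"
    "dist wb w \<le> R / 3" if "invar n (x, y, z, w)" for n x y z w
  proof -
    have "L * ((1 - q ^ n) * \<rho>) \<le> L * \<rho>" "M * ((1 - q ^ n) * \<rho>) \<le> M * \<rho>"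
      using acc_le[of n] L_pos M_pos by simp_all
    moreover have "dist x0 x \<le> (1 - q ^ n) * \<rho>" "dist y0 y \<le> L * ((1 - q ^ n) * \<rho>)"
      "dist z0 z \<le> M * ((1 - q ^ n) * \<rho>)"
      using that unfolding invar_def by simp_all
    ultimately have s: "dist x0 x \<le> \<rho>" "dist y0 y \<le> L * \<rho>" "dist z0 z \<le> M * \<rho>"
      using acc_le[of n] by linarith+
    have "L * C * \<sigma> n \<le> L * C * \<rho>" "L * C * ((1 - q) * \<rho>) \<le> L * C * \<rho>"
      using \<sigma>_le[of n] \<sigma>_le[of 0] pos by (auto intro!: mult_left_mono simp: \<sigma>_def)
    then have d: "dist w v \<le> L * C * \<rho>" "dist w0 v \<le> L * C * \<rho>"
      using that v unfolding invar_def by auto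
    show "dist xb x + \<rho> \<le> R / 3"
      using s near' dist_triangle[of xb x x0] small \<eta>' prods pos by linarith
    show "dist yb y + L * \<rho> \<le> R / 3"
      using s near' dist_triangle[of yb y y0] small \<eta>' prods pos by linarith
    show "dist zb z + M * \<rho> \<le> R / 3"
      using s near' dist_triangle[of zb z z0] small \<eta>' prods pos by linarith
    show "dist wb w \<le> R / 3"
      using d near' dist_triangle[of wb w w0] dist_triangle2[of w0 w v] small \<eta>' prods pos by linarith
  qed
  have "L * C * ((1 - q) * \<rho>) \<le> L * C * \<rho>"
    using \<sigma>_le[of 0] pos by (auto intro!: mult_left_mono simp: \<sigma>_def)
  then have "dist wb v \<le> R"
    using v near' dist_triangle[of wb v w0] small \<eta>' prods pos by linarith
  then have v_near: "v \<in> cball wb R" by simp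
  \<comment> \<open>The step sizes are recorded as well, since the invariant alone does not make the iterates Cauchy.\<close>
  have step: "\<exists>s'. invar (Suc n) s' \<and>
       (case (s, s') of ((x, y, z, w), (x', y', z', w')) \<Rightarrow>
         dist x' x \<le> \<sigma> n \<and> dist y' y \<le> L * \<sigma> n \<and> dist z' z \<le> M * \<sigma> n)"
    if "invar n s" for n s
  proof -
    obtain x y z w where s: "s = (x, y, z, w)" by (cases s)
    note I = that[unfolded s]
    have less: "L * \<sigma> n \<le> L * \<rho>" "M * \<sigma> n \<le> M * \<rho>"
      using \<sigma>_le[of n] L_pos M_pos by simp_all
    have R: "R > 0" "\<rho> < R" "L * \<rho> < R" using small \<eta>' prods pos by linarith+
    have inclusions: "y \<in> F1 x" "z \<in> F2 x" "w \<in> G (y, z)" and error: "dist w v < L * C * \<sigma> n"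
      using I by (simp_all add: invar_def)
    have sizes: "\<sigma> n < R" "L * \<sigma> n < R"
      using \<sigma>_le[of n] less R by linarith+
    have room: "dist xb x + \<sigma> n \<le> R" "dist yb y + L * \<sigma> n \<le> R" "dist zb z + M * \<sigma> n \<le> R"
      using bounds[OF I] \<sigma>_le[of n] less R by linarith+
    have w_near: "w \<in> cball wb R"
      using bounds[OF I] R by simp
    obtain x' y' z' w' where new: "y' \<in> F1 x'" "z' \<in> F2 x'" "w' \<in> G (y', z')"
      "dist x' x \<le> \<sigma> n" "dist y' y \<le> L * \<sigma> n" "dist z' z \<le> M * \<sigma> n" "dist w' v \<le> M * D * \<sigma> n"
      by (rule correction_step[OF inclusions \<sigma>_pos sizes room w_near v_near error])
    have "dist x0 x' \<le> (1 - q ^ Suc n) * \<rho>"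
      using I new dist_triangle[of x0 x' x] acc[of n] by (simp add: invar_def dist_commute)
    moreover have "dist y0 y' \<le> L * ((1 - q ^ Suc n) * \<rho>)"
      unfolding acc[of n, symmetric] distrib_left
      using I new dist_triangle[of y0 y' y] by (simp add: invar_def dist_commute)
    moreover have "dist z0 z' \<le> M * ((1 - q ^ Suc n) * \<rho>)"
      unfolding acc[of n, symmetric] distrib_left
      using I new dist_triangle[of z0 z' z] by (simp add: invar_def dist_commute)
    moreover have "dist w' v < L * C * \<sigma> (Suc n)"
    proof -
      have "M * D * \<sigma> n < q * (L * C) * \<sigma> n"
        using q(3) \<sigma>_pos[of n] by (rule mult_strict_right_mono)
      then show ?thesis
        using new by (simp add: \<sigma>_def ac_simps)
    qed
    ultimately have "invar (Suc n) (x', y', z', w')"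
      using new by (simp add: invar_def)
    then show ?thesis
      using new s by (intro exI[of _ "(x', y', z', w')"]) simp
  qed
  have "invar 0 (x0, y0, z0, w0)"
    using start v by (simp add: invar_def \<sigma>_def)
  then have "\<exists>s0. invar 0 s0" by blast
  from dependent_nat_choice[of invar, OF this step]
  obtain s where "\<forall>n. invar n (s n) \<and> (case (s n, s (Suc n)) of ((x, y, z, w), (x', y', z', w')) \<Rightarrow>
         dist x' x \<le> \<sigma> n \<and> dist y' y \<le> L * \<sigma> n \<and> dist z' z \<le> M * \<sigma> n)"
    by (rule exE)
  then have s: "\<And>n. invar n (s n)"
    and steps: "\<And>n. case (s n, s (Suc n)) of ((x, y, z, w), (x', y', z', w')) \<Rightarrow>
         dist x' x \<le> \<sigma> n \<and> dist y' y \<le> L * \<sigma> n \<and> dist z' z \<le> M * \<sigma> n"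
    by simp_all
  define X Y Z W where "X n = fst (s n)" and "Y n = fst (snd (s n))"
    and "Z n = fst (snd (snd (s n)))" and "W n = snd (snd (snd (s n)))" for n
  have s_eq: "s n = (X n, Y n, Z n, W n)" for n
    by (simp add: X_def Y_def Z_def W_def)
  note I = s[unfolded s_eq]
  note J = steps[unfolded s_eq, simplified]
  have "convergent X"
    using q(1,2) by (rule geometric_steps_convergent[where c = "(1 - q) * \<rho>"])
      (use J in \<open>simp add: \<sigma>_def ac_simps\<close>)
  then obtain x where x: "X \<longlonglongrightarrow> x" by (auto simp: convergent_def)
  have "convergent Y"
    using q(1,2) by (rule geometric_steps_convergent[where c = "L * ((1 - q) * \<rho>)"])
      (use J in \<open>simp add: \<sigma>_def ac_simps\<close>)
  then obtain y where y: "Y \<longlonglongrightarrow> y" by (auto simp: convergent_def)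
  have "convergent Z"
    using q(1,2) by (rule geometric_steps_convergent[where c = "M * ((1 - q) * \<rho>)"])
      (use J in \<open>simp add: \<sigma>_def ac_simps\<close>)
  then obtain z where z: "Z \<longlonglongrightarrow> z" by (auto simp: convergent_def)
  have "\<sigma> \<longlonglongrightarrow> 0"
    unfolding \<sigma>_def using q by (intro tendsto_mult_left_zero LIMSEQ_power_zero) simp
  then have "(\<lambda>n. L * C * \<sigma> n) \<longlonglongrightarrow> 0"
    by (rule tendsto_mult_right_zero)
  then have "(\<lambda>n. dist (W n) v) \<longlonglongrightarrow> 0"
    by (rule Lim_null_comparison[rotated])
      (use I in \<open>simp add: invar_def less_imp_le\<close>)
  then have W: "W \<longlonglongrightarrow> v"
    by (rule iffD2[OF tendsto_dist_iff])
  have prod_dist: "dist (a, b) (c, d) \<le> dist a c + dist b d"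
    for a c :: "'p::metric_space" and b d :: "'q::metric_space"
    by (simp add: dist_Pair_Pair sqrt_sum_squares_le_sum)
  have xyzw: "dist xb (X n) \<le> R / 3" "dist yb (Y n) \<le> R / 3" "dist zb (Z n) \<le> R / 3"
    "dist wb (W n) \<le> R / 3" for n
    using bounds[OF I[of n]] \<rho>(1) L_pos M_pos mult_pos_pos[of L \<rho>] mult_pos_pos[of M \<rho>] by linarith+
  have R_nonneg: "0 \<le> R"
    using xyzw(1)[of 0] zero_le_dist[of xb "X 0"] by linarith
  have "(x, y) \<in> mf_graph F1 \<inter> cball (xb, yb) R"
  proof (rule closed_sequentially[OF closed_F1])
    show "(\<lambda>n. (X n, Y n)) \<longlonglongrightarrow> (x, y)" using x y by (rule tendsto_Pair)
    show "(X n, Y n) \<in> mf_graph F1 \<inter> cball (xb, yb) R" for n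
      using I[of n] xyzw[of n] prod_dist[of xb yb "X n" "Y n"] R_nonneg
      by (auto simp: invar_def mf_graph_def)
  qed
  moreover have "(x, z) \<in> mf_graph F2 \<inter> cball (xb, zb) R"
  proof (rule closed_sequentially[OF closed_F2])
    show "(\<lambda>n. (X n, Z n)) \<longlonglongrightarrow> (x, z)" using x z by (rule tendsto_Pair)
    show "(X n, Z n) \<in> mf_graph F2 \<inter> cball (xb, zb) R" for n
      using I[of n] xyzw[of n] prod_dist[of xb zb "X n" "Z n"] R_nonneg
      by (auto simp: invar_def mf_graph_def)
  qed
  moreover have "((y, z), v) \<in> mf_graph G \<inter> cball ((yb, zb), wb) R"
  proof (rule closed_sequentially[OF closed_G])
    show "(\<lambda>n. ((Y n, Z n), W n)) \<longlonglongrightarrow> ((y, z), v)" using y z W by (intro tendsto_Pair)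
    show "((Y n, Z n), W n) \<in> mf_graph G \<inter> cball ((yb, zb), wb) R" for n
      using I[of n] xyzw[of n] prod_dist[of yb zb "Y n" "Z n"]
        prod_dist[of "(yb, zb)" wb "(Y n, Z n)" "W n"]
      by (auto simp: invar_def mf_graph_def)
  qed
  moreover have "dist x0 x \<le> \<rho>"
  proof (rule Lim_bounded)
    show "(\<lambda>n. dist x0 (X n)) \<longlonglongrightarrow> dist x0 x" using x by (intro tendsto_intros)
    show "\<forall>n\<ge>0. dist x0 (X n) \<le> \<rho>"
    proof (intro allI impI)
      show "dist x0 (X n) \<le> \<rho>" for n
        using I[of n] acc_le[of n] by (simp add: invar_def)
    qed
  qed
  ultimately show thesis
    by (intro that[of y x z]) (auto simp: mf_graph_def)
qed

text \<open>
  The strict inequality \<open>norm (v - w0) < (L * C - M * D) * \<rho>\<close> leaves room to shrink \<open>\<rho>\<close>, so that the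
  solution lies in the open ball, and then to take \<open>q\<close> strictly above \<open>M * D / (L * C)\<close>.
\<close>

lemma ball_subset_image:
  assumes rate: "L * C - M * D > 0"
    and start: "y0 \<in> F1 x0" "z0 \<in> F2 x0" "w0 \<in> G (y0, z0)"
    and near: "x0 \<in> ball xb \<eta>" "y0 \<in> ball yb \<eta>" "z0 \<in> ball zb \<eta>" "w0 \<in> ball wb \<eta>"
    and \<rho>: "0 < \<rho>" "\<rho> < \<eta>"
    and \<eta>: "\<eta> * (3 + 2 * (L + M + L * C)) \<le> R / 3"
  shows "ball w0 ((L * C - M * D) * \<rho>) \<subseteq> mf_image (\<lambda>x. \<Union>y\<in>F1 x. \<Union>z\<in>F2 x. G (y, z)) (ball x0 \<rho>)"
proof
  fix v assume "v \<in> ball w0 ((L * C - M * D) * \<rho>)"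
  then have "dist w0 v / (L * C - M * D) < \<rho>"
    using rate by (simp add: field_simps)
  then obtain r where r: "dist w0 v / (L * C - M * D) < r" "r < \<rho>"
    using dense by blast
  have "0 \<le> dist w0 v / (L * C - M * D)" using rate by simp
  then have r_pos: "0 < r" using r by linarith
  have LC: "0 < L * C" using L_pos C_pos by simp
  have "M * D / (L * C) < 1 - dist w0 v / (L * C * r)"
    using r(1) rate LC r_pos L_pos C_pos by (simp add: field_simps)
  then obtain q where q: "M * D / (L * C) < q" "q < 1 - dist w0 v / (L * C * r)"
    using dense by blast
  have "0 \<le> M * D / (L * C)" using M_pos D_nonneg LC by simp
  then have q0: "0 < q" using q by linarith
  have "0 \<le> dist w0 v / (L * C * r)" using LC r_pos by simp
  then have q1: "q < 1" using q by linarith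
  have q2: "M * D < q * (L * C)"
    using q(1) LC by (simp add: pos_divide_less_eq)
  have "dist w0 v / (L * C * r) < 1 - q" using q(2) by linarith
  then have "dist w0 v < L * C * ((1 - q) * r)"
    using LC r_pos by (simp add: pos_divide_less_eq) (simp add: ac_simps)
  moreover have "r < \<eta>" using r(2) \<rho>(2) by linarith
  ultimately obtain x y z where xyz: "y \<in> F1 x" "z \<in> F2 x" "v \<in> G (y, z)" "dist x0 x \<le> r"
    using target_attained[OF q0 q1 q2 start near r_pos _ \<eta>] by blast
  have "x \<in> ball x0 \<rho>" using xyz(4) r(2) by simp
  then show "v \<in> mf_image (\<lambda>x. \<Union>y\<in>F1 x. \<Union>z\<in>F2 x. G (y, z)) (ball x0 \<rho>)"
    using xyz(1-3) unfolding mf_image_def by blast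
qed

end

section \<open>Openness of the composition\<close>

theorem theorem3p4:
  fixes F1 :: "'x::banach \<Rightarrow> 'y::banach set"
    and F2 :: "'x \<Rightarrow> 'z::banach set"
    and G :: "'y \<times> 'z \<Rightarrow> 'w::banach set"
    and H :: "'x \<Rightarrow> 'w set"
    and xb :: 'x and yb :: 'y and zb :: 'z and wb :: 'w
    and L M C D :: real
  assumes "(xb, yb) \<in> mf_graph F1"
    and "(xb, zb) \<in> mf_graph F2"
    and "((yb, zb), wb) \<in> mf_graph G"
    and "\<And>x. H x = (\<Union>y\<in>F1 x. \<Union>z\<in>F2 x. G (y, z))"
    and "locally_closed_around (mf_graph F1) (xb, yb)"
    and "locally_closed_around (mf_graph F2) (xb, zb)"
    and "locally_closed_around (mf_graph G) ((yb, zb), wb)"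
    and "L > 0" and "open_at_linear_rate F1 L (xb, yb)"
    and "M > 0" and "lipschitz_like F2 M (xb, zb)"
    and "C > 0" and "open_at_linear_rate_fst_uniformly G C ((yb, zb), wb)"
    and "D \<ge> 0" and "lipschitz_like_snd_uniformly G D ((yb, zb), wb)"
    and "L * C - M * D > 0"
  shows "\<exists>\<epsilon>>0.
    (\<forall>\<rho>\<in>{0<..<\<epsilon>}. ball wb ((L * C - M * D) * \<rho>) \<subseteq> mf_image H (ball xb \<rho>)) \<and>
    (\<forall>\<rho>\<in>{0<..<\<epsilon> / 2}.
      \<forall>(x, y, z, w) \<in> ball xb (\<epsilon> / 2) \<times> ball yb (\<epsilon> / 2) \<times> ball zb (\<epsilon> / 2) \<times> ball wb (\<epsilon> / 2).
        (y, z) \<in> F1 x \<times> F2 x \<and> w \<in> G (y, z) \<longrightarrow>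
        ball w ((L * C - M * D) * \<rho>) \<subseteq> mf_image H (ball x \<rho>))"
proof -
  have "\<forall>\<^sub>F R in at_right 0. 0 < R \<and> local_composition F1 F2 G xb yb zb wb L M C D R"
    using eventually_at_right_less[of "0 :: real"]
      assms(5-7)[THEN eventually_closed_Int_cball]
      eventually_open_at_linear_rate[OF assms(9)]
      eventually_lipschitz_like[OF assms(11) less_imp_le[OF assms(10)]]
      eventually_open_at_linear_rate_fst_uniformly[OF assms(13)]
      eventually_lipschitz_like_snd_uniformly[OF assms(15,14)]
  proof eventually_elim
    case (elim R)
    show ?case
      by (intro conjI local_composition.intro) (use elim assms(8,10,12,14) in auto)
  qed
  then obtain R where "0 < R" and loc: "local_composition F1 F2 G xb yb zb wb L M C D R"
    using eventually_happens'[OF trivial_limit_at_right_real] by blast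
  interpret local_composition F1 F2 G xb yb zb wb L M C D R by (fact loc)
  define k where "k = 3 + 2 * (L + M + L * C)"
  have k: "0 < k"
    using assms(8,10,12) by (simp add: k_def add_pos_pos)
  define \<epsilon> where "\<epsilon> = R / (3 * k)"
  have "0 < \<epsilon>" using \<open>0 < R\<close> k by (simp add: \<epsilon>_def)
  have "\<epsilon> * k \<le> R / 3"
    using k by (simp add: \<epsilon>_def)
  note \<epsilon> = this[unfolded k_def]
  have H: "H = (\<lambda>x. \<Union>y\<in>F1 x. \<Union>z\<in>F2 x. G (y, z))"
    using assms(4) by blast
  note main = ball_subset_image[OF assms(16) _ _ _ _ _ _ _ _ _ \<epsilon>, folded H]
  show ?thesis
  proof (intro exI[of _ \<epsilon>] conjI ballI)
    show "0 < \<epsilon>" by fact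
  next
    fix \<rho> assume "\<rho> \<in> {0<..<\<epsilon>}"
    then show "ball wb ((L * C - M * D) * \<rho>) \<subseteq> mf_image H (ball xb \<rho>)"
      using main[of yb xb zb wb \<rho>] assms(1-3) \<open>0 < \<epsilon>\<close> by (simp add: mf_graph_def)
  next
    fix \<rho> p
    assume \<rho>: "\<rho> \<in> {0<..<\<epsilon> / 2}"
      and p: "p \<in> ball xb (\<epsilon> / 2) \<times> ball yb (\<epsilon> / 2) \<times> ball zb (\<epsilon> / 2) \<times> ball wb (\<epsilon> / 2)"
    obtain x y z w where xyzw: "p = (x, y, z, w)" by (cases p)
    have "ball w ((L * C - M * D) * \<rho>) \<subseteq> mf_image H (ball x \<rho>)"
      if "y \<in> F1 x" "z \<in> F2 x" "w \<in> G (y, z)"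
    proof (rule main[OF that])
      show "x \<in> ball xb \<epsilon>" "y \<in> ball yb \<epsilon>" "z \<in> ball zb \<epsilon>" "w \<in> ball wb \<epsilon>"
        "0 < \<rho>" "\<rho> < \<epsilon>"
        using p \<rho> \<open>0 < \<epsilon>\<close> unfolding xyzw by auto
    qed
    then show "case p of (x, y, z, w) \<Rightarrow> (y, z) \<in> F1 x \<times> F2 x \<and> w \<in> G (y, z) \<longrightarrow>
        ball w ((L * C - M * D) * \<rho>) \<subseteq> mf_image H (ball x \<rho>)"
      unfolding xyzw by simp
  qed
qed

end
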